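(* Suppose that $\nu$ is a probability measure on $\mathbb{R}$ with $\mathrm{supp}\,\nu = \{0, \lambda\}$ for some $\lambda > 0$. Given an arbitrary $\omega = (\omega_n)_{n\in\mathbb{Z}} \in \Omega = (\mathrm{supp}\,\nu)^{\mathbb{Z}}$ and a solution $u : \mathbb{Z} \to \mathbb{R}$ of the difference equation $$u(n+1) + u(n-1) + \omega_n u(n) = E u(n), \quad n \in \mathbb{Z},$$ at energy $E = 2 + \lambda$ that has strictly positive entries (i.e. $u(n) > 0$ for all $n \in \mathbb{Z}$), we must have $$\liminf_{n \to \infty} u(n) > 0 \quad \text{or} \quad \liminf_{n \to -\infty} u(n) > 0.$$ *)

theory Defs
  imports "HOL-Probability.Probability"
begin

text \<open>The topological support of a Borel measure: the points all of whose open
  neighbourhoods have positive mass.\<close>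

definition msupp :: "'a::topological_space measure \<Rightarrow> 'a set" where
  "msupp M = {x. \<forall>U. open U \<and> x \<in> U \<longrightarrow> emeasure M U > 0}"

definition config_space :: "real measure \<Rightarrow> (int \<Rightarrow> real) set" where
  "config_space \<nu> = (UNIV :: int set) \<rightarrow> msupp \<nu>"

definition schroedinger_solution :: "(int \<Rightarrow> real) \<Rightarrow> real \<Rightarrow> (int \<Rightarrow> real) \<Rightarrow> bool" where
  "schroedinger_solution \<omega> E u \<longleftrightarrow> (\<forall>n. u (n + 1) + u (n - 1) + \<omega> n * u n = E * u n)"

end

theory Submission
  imports Defs
begin

text \<open>At the energy \<open>E = 2 + lam\<close> the equation reads
  \<open>u (n + 1) - 2 * u n + u (n - 1) = (lam - \<omega> n) * u n\<close>, and the right-hand side is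
  nonnegative because \<open>\<omega> n \<le> lam\<close> and \<open>u n > 0\<close>. So \<open>u\<close> is a convex sequence on the integers.
  A convex sequence that does not decrease from \<open>0\<close> to \<open>1\<close> never decreases afterwards; one that
  does decrease there has been decreasing all the way from \<open>-\<infinity>\<close>. Hence \<open>u\<close> is bounded below
  by \<open>u 0 > 0\<close> on at least one of the two half-lines.\<close>

lemma convex_sequence_ge_initial:
  fixes f :: "int \<Rightarrow> real"
  assumes convex: "\<And>n. 2 * f n \<le> f (n + 1) + f (n - 1)"
    and "f 0 \<le> f 1" and "0 \<le> n"
  shows "f 0 \<le> f n"
proof -
  \<comment> \<open>Increments of a convex sequence grow, so the sign of the first one propagates; this has to
      be carried through the induction together with the bound.\<close>
  have "f 0 \<le> f n \<and> f n \<le> f (n + 1)"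
    using \<open>0 \<le> n\<close>
  proof (induction n rule: int_ge_induct)
    case base
    show ?case using \<open>f 0 \<le> f 1\<close> by simp
  next
    case (step i)
    then show ?case using convex[of "i + 1"] by simp
  qed
  then show ?thesis ..
qed

theorem theorem1p4:
  fixes \<nu> :: "real measure" and lam E :: real and \<omega> u :: "int \<Rightarrow> real"
  assumes "real_distribution \<nu>"
    and "lam > 0"
    and "msupp \<nu> = {0, lam}"
    and "\<omega> \<in> config_space \<nu>"
    and "E = 2 + lam"
    and "schroedinger_solution \<omega> E u"
    and "\<And>n. u n > 0"
  shows "Liminf at_top (\<lambda>n. ereal (u n)) > 0 \<or> Liminf at_bot (\<lambda>n. ereal (u n)) > 0"
proof -
  have convex: "2 * u n \<le> u (n + 1) + u (n - 1)" for n
  proof -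
    have "\<omega> n \<in> {0, lam}"
      using assms(3,4) unfolding config_space_def by auto
    then have "0 \<le> (lam - \<omega> n) * u n"
      using \<open>lam > 0\<close> assms(7)[of n] by auto
    moreover have "u (n + 1) + u (n - 1) + \<omega> n * u n = (2 + lam) * u n"
      using assms(5,6) unfolding schroedinger_solution_def by simp
    ultimately show ?thesis by (simp add: algebra_simps)
  qed
  have Liminf_pos: "Liminf F (\<lambda>n. ereal (u n)) > 0" if "\<forall>\<^sub>F n in F. u 0 \<le> u n" for F
  proof -
    have "ereal (u 0) \<le> Liminf F (\<lambda>n. ereal (u n))"
      using that by (intro Liminf_bounded) simp
    moreover have "0 < ereal (u 0)"
      using assms(7) by simp
    ultimately show ?thesis by (rule less_le_trans[rotated])
  qed
  show ?thesis
  proof (cases "u 0 \<le> u 1")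
    case True
    then have "\<forall>\<^sub>F n in at_top. u 0 \<le> u n"
      using convex_sequence_ge_initial[of u] convex
      by (auto simp: eventually_at_top_linorder)
    then show ?thesis using Liminf_pos by blast
  next
    case False
    \<comment> \<open>Convexity at \<open>0\<close> makes the reflected sequence increase from \<open>0\<close> to \<open>1\<close>.\<close>
    then have "u 0 \<le> u (- 1)"
      using convex[of 0] by simp
    moreover have "2 * u (- n) \<le> u (- (n + 1)) + u (- (n - 1))" for n
    proof -
      have "- (n + 1) = - n - 1" and "- (n - 1) = - n + 1" by simp_all
      then show ?thesis using convex[of "- n"] by (metis add.commute)
    qed
    ultimately have "u 0 \<le> u (- n)" if "0 \<le> n" for n
      using convex_sequence_ge_initial[of "\<lambda>n. u (- n)" n] that by simp
    then have "u 0 \<le> u n" if "n \<le> 0" for n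
      using that by (metis minus_minus neg_0_le_iff_le)
    then have "\<forall>\<^sub>F n in at_bot. u 0 \<le> u n"
      by (auto simp: eventually_at_bot_linorder)
    then show ?thesis using Liminf_pos by blast
  qed
qed

end
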